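(* Let $n\in\mathbb{N}$, let $\phi=(\phi_1,\dots,\phi_n):U^n\to U^n$ be holomorphic, and let $0<p,q<1$. Then the following statements are equivalent: (a) $C_\phi$ is a bounded operator from $\mathcal{L}_p(U^n)$ to $\mathcal{L}_q(U^n)$; (b) there is a $C\ge 0$ such that for all $z\in U^n$, $$\sum_{k,l=1}^n\left|\frac{\partial \phi_l}{\partial z_k}(z)\right|\frac{(1-|z_k|^2)^{1-q}}{(1-|\phi_l(z)|^2)^{1-p}}\le C.$$
   Context: $U$ is the open unit disk in $\mathbb{C}$ and $U^n\subset\mathbb{C}^n$ is the open unit polydisk. For a holomorphic self-map $\phi$ of $U^n$, the composition operator is $C_\phi f=f\circ\phi$ for $f$ holomorphic on $U^n$. For $p\in(0,1]$, the holomorphic $p$-Lipschitz space $\mathcal{L}_p(U^n)$ is the Banach space of holomorphic $f:U^n\to\mathbb{C}$ with finite norm $$\|f\|_{\mathcal{L}_p}=|f(0)|+\sup_{z\ne w\in U^n}\frac{|f(z)-f(w)|}{|z-w|^p},$$ where $|z-w|$ is the Euclidean norm on $\mathbb{C}^n$. Saying $C_\phi$ is a bounded operator from $X$ to $Y$ means that $C_\phi$ maps $X$ into $Y$ and is bounded for the respective norms. *)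

theory Defs
  imports "HOL-Complex_Analysis.Complex_Analysis"
begin

definition polydisk :: "(complex ^ 'n) set" where
  "polydisk = {z. \<forall>k. z $ k \<in> ball 0 1}"

text \<open>Holomorphy in several variables on an open set: at each point the real Frechet
  derivative exists and is linear over the complex numbers.\<close>

definition holomorphic_Cn_on :: "(complex ^ 'n \<Rightarrow> complex) \<Rightarrow> (complex ^ 'n) set \<Rightarrow> bool" where
  "holomorphic_Cn_on f S \<longleftrightarrow>
     (\<forall>z\<in>S. \<exists>L. Vector_Spaces.linear (*s) (*) L \<and> (f has_derivative L) (at z))"

definition holomorphic_map_Cn_on ::
    "(complex ^ 'n \<Rightarrow> complex ^ 'm) \<Rightarrow> (complex ^ 'n) set \<Rightarrow> bool" where
  "holomorphic_map_Cn_on F S \<longleftrightarrow> (\<forall>l. holomorphic_Cn_on (\<lambda>z. F z $ l) S)"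

definition partial_deriv :: "'n \<Rightarrow> (complex ^ 'n \<Rightarrow> complex) \<Rightarrow> complex ^ 'n \<Rightarrow> complex" where
  "partial_deriv k f z = deriv (\<lambda>\<zeta>. f (\<chi> j. if j = k then \<zeta> else z $ j)) (z $ k)"

text \<open>The norm on \<^typ>\<open>complex ^ 'n\<close> is the Euclidean one.  Functions are total, but
  only their values on the polydisk matter below.\<close>

definition lip_quotients :: "real \<Rightarrow> (complex ^ 'n \<Rightarrow> complex) \<Rightarrow> real set" where
  "lip_quotients p f =
     {norm (f z - f w) / norm (z - w) powr p | z w. z \<in> polydisk \<and> w \<in> polydisk \<and> z \<noteq> w}"

definition lip_space :: "real \<Rightarrow> (complex ^ 'n \<Rightarrow> complex) set" where
  "lip_space p = {f. holomorphic_Cn_on f polydisk \<and> bdd_above (lip_quotients p f)}"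

definition lip_norm :: "real \<Rightarrow> (complex ^ 'n \<Rightarrow> complex) \<Rightarrow> real" where
  "lip_norm p f = norm (f 0) + Sup (lip_quotients p f)"

definition composition_op ::
    "(complex ^ 'n \<Rightarrow> complex ^ 'n) \<Rightarrow> (complex ^ 'n \<Rightarrow> complex) \<Rightarrow> complex ^ 'n \<Rightarrow> complex" where
  "composition_op \<phi> f = f \<circ> \<phi>"

text \<open>Linearity is not demanded here, since composition operators are always linear.\<close>

definition bounded_operator ::
    "'a set \<Rightarrow> ('a \<Rightarrow> real) \<Rightarrow> 'b set \<Rightarrow> ('b \<Rightarrow> real) \<Rightarrow> ('a \<Rightarrow> 'b) \<Rightarrow> bool" where
  "bounded_operator X normX Y normY T \<longleftrightarrow>
     T ` X \<subseteq> Y \<and> (\<exists>K. \<forall>f\<in>X. normY (T f) \<le> K * normX f)"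

end

(* Both directions rest on the Hardy--Littlewood description of the Lipschitz classes, applied in
   each variable separately: f is p-Lipschitz on the polydisk iff |D_k f(z)| (1 - |z_k|^2)^(1-p)
   is bounded for every k, with comparable constants.  Sufficiency of the weight condition is
   then the chain rule.  For necessity one tests the operator on f(w) = (1 - conj(u) w_l)^p with
   |u| = 1: these functions have uniformly bounded norms, and for u the direction of the l-th
   coordinate of phi(z) the derivative of f at phi(z) has the extremal size
   p (1 - |phi_l(z)|)^(p-1). *)

theory Submission
  imports Defs
begin

no_notation fps_nth (infixl "$" 75)

section \<open>Powers of the distance to the boundary\<close>

text \<open>Turns a weighted estimate into a growth estimate. Below, \<open>t\<close> is
  \<open>1 - (norm w)\<^sup>2\<close> and \<open>s\<close> a lower bound for the distance from
  \<open>w\<close> to the unit circle.\<close>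

lemma le_mult_powr_uminus:
  fixes D t s M e :: real
  assumes "D * t powr e \<le> M" "0 \<le> D" "0 \<le> e" "0 < s" "s \<le> t"
  shows "D \<le> M * s powr (- e)"
proof -
  have "s powr e \<le> t powr e"
    using assms by (intro powr_mono2) auto
  then have "D * s powr e \<le> M"
    using assms(1,2) mult_left_mono[of "s powr e" "t powr e" D] by linarith
  then show ?thesis
    using assms by (simp add: powr_minus field_simps)
qed

lemma powr_uminus_mult_powr: "0 < x \<Longrightarrow> x powr (- e) * x powr e = (1 :: real)"
  by (simp flip: powr_add)

text \<open>The factorisation \<open>(1 - r) * (1 + r)\<close> with \<open>1 + r\<close> between 1
  and 2 makes the weight comparable with the distance \<open>1 - r\<close> to the boundary.\<close>

lemma one_minus_square_bounds:
  fixes r :: real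
  assumes "0 \<le> r" "r < 1"
  shows "0 < 1 - r\<^sup>2" "1 - r \<le> 1 - r\<^sup>2" "1 - r\<^sup>2 \<le> 2 * (1 - r)"
proof -
  have "1 - r\<^sup>2 = (1 - r) * (1 + r)" by (simp add: algebra_simps power2_eq_square)
  moreover have "(1 - r) * 1 \<le> (1 - r) * (1 + r)" "(1 - r) * (1 + r) \<le> (1 - r) * 2"
    using assms by (intro mult_left_mono; simp)+
  ultimately show "0 < 1 - r\<^sup>2" "1 - r \<le> 1 - r\<^sup>2" "1 - r\<^sup>2 \<le> 2 * (1 - r)"
    using assms by auto
qed

section \<open>The Hardy--Littlewood theorem in one variable\<close>

text \<open>Cauchy's estimate for \<open>g x - g z\<close> on a circle of radius \<open>r\<close>
  around \<open>z\<close>: the Lipschitz condition bounds this difference by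
  \<open>M * r powr p\<close>, hence the derivative by \<open>M * r powr (p - 1)\<close>. The factor
  4 bounds \<open>4 powr (1 - p)\<close>.\<close>

lemma hardy_littlewood_deriv_bound:
  fixes g :: "complex \<Rightarrow> complex"
  assumes hol: "g holomorphic_on ball 0 1"
    and lip: "\<And>x y. x \<in> ball 0 1 \<Longrightarrow> y \<in> ball 0 1 \<Longrightarrow> norm (g x - g y) \<le> M * norm (x - y) powr p"
    and p: "0 < p" "p < 1" and z: "norm z < 1"
  shows "norm (deriv g z) * (1 - (norm z)\<^sup>2) powr (1 - p) \<le> 4 * M"
proof -
  \<comment> \<open>The quarter makes the weight exactly \<open>4 * r\<close>, and \<open>r\<close>
    is at most half the distance from \<open>z\<close> to the unit circle, so the closed disk stays
    inside the open one.\<close>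
  define r where "r = (1 - (norm z)\<^sup>2) / 4"
  note b = one_minus_square_bounds[OF norm_ge_zero z]
  have r4: "1 - (norm z)\<^sup>2 = 4 * r" by (simp add: r_def)
  have r: "0 < r" "2 * r \<le> 1 - norm z" using b by (auto simp: r_def)
  have sub: "cball z r \<subseteq> ball 0 1"
    using r by (auto simp: cball_def dist_norm) (smt (verit) norm_triangle_sub norm_minus_commute)
  have M: "0 \<le> M"
  proof -
    have "0 \<le> norm (g (1/2) - g 0)" by simp
    also have "\<dots> \<le> M * norm (1/2 - 0 :: complex) powr p" by (intro lip) auto
    finally show ?thesis by (metis mult_neg_pos not_le powr_gt_zero norm_eq_zero diff_zero zero_neq_numeral one_neq_zero divide_eq_0_iff)
  qed
  have h: "(\<lambda>x. g x - g z) holomorphic_on ball 0 1" by (intro holomorphic_intros hol)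
  have "norm ((deriv ^^ 1) (\<lambda>x. g x - g z) z) \<le> fact 1 * (M * r powr p) / r ^ 1"
  proof (rule Cauchy_inequality)
    show "(\<lambda>x. g x - g z) holomorphic_on ball z r"
      using h sub ball_subset_cball holomorphic_on_subset by blast
    show "continuous_on (cball z r) (\<lambda>x. g x - g z)"
      using h sub holomorphic_on_imp_continuous_on continuous_on_subset by blast
    show "norm (g x - g z) \<le> M * r powr p" if "norm (z - x) = r" for x
      using lip[of x z] that sub z by (auto simp: norm_minus_commute subset_eq dist_norm)
  qed (use r in auto)
  moreover have "deriv (\<lambda>x. g x - g z) z = deriv g z"
    using holomorphic_on_imp_differentiable_at[OF hol open_ball, of z] z by simp
  ultimately have "norm (deriv g z) \<le> M * r powr p / r" by simp
  also have "\<dots> = M * r powr - (1 - p)" using r by (simp add: powr_diff)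
  finally have "norm (deriv g z) * (1 - (norm z)\<^sup>2) powr (1 - p)
      \<le> M * r powr - (1 - p) * (4 * r) powr (1 - p)"
    unfolding r4 by (intro mult_right_mono) auto
  also have "\<dots> = M * 4 powr (1 - p) * (r powr - (1 - p) * r powr (1 - p))"
    using r by (simp add: powr_mult)
  also have "r powr - (1 - p) * r powr (1 - p) = 1"
    using r(1) by (rule powr_uminus_mult_powr)
  also have "M * 4 powr (1 - p) * 1 \<le> M * 4 powr 1"
    unfolding mult_1_right using M p by (intro mult_left_mono powr_mono) auto
  finally show ?thesis by simp
qed

text \<open>The point \<open>(1 - s) * x\<close> is at distance at least \<open>s\<close> from the
  unit circle, so the derivative there is at most \<open>M * s powr (p - 1)\<close>; integrating
  from 0 to \<open>h\<close> gives the bound.\<close>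

lemma radial_increment_bound:
  fixes g :: "complex \<Rightarrow> complex"
  assumes hol: "g holomorphic_on ball 0 1"
    and der: "\<And>z. norm z < 1 \<Longrightarrow> norm (deriv g z) * (1 - (norm z)\<^sup>2) powr (1 - p) \<le> M"
    and p: "0 < p" "p < 1" and x: "norm x < 1" and h: "0 < h" "h \<le> 1"
  shows "norm (g (of_real (1 - h) * x) - g x) \<le> M / p * h powr p"
proof -
  define F where "F = g \<circ> (\<lambda>s. of_real (1 - s) * x)"
  have small: "norm (of_real (1 - s) * x) \<le> (1 - s) * norm x" if "0 \<le> s" "s \<le> 1" for s
    using that by (simp add: norm_mult del: of_real_diff)
  have small': "norm (of_real (1 - s) * x) < 1" "s \<le> 1 - norm (of_real (1 - s) * x)"
    if "0 \<le> s" "s \<le> 1" for s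
  proof -
    have "norm (of_real (1 - s) * x) \<le> 1 * norm x"
      using small[OF that] mult_right_mono[of "1 - s" 1 "norm x"] that by simp
    then show "norm (of_real (1 - s) * x) < 1" using x by simp
    have "norm (of_real (1 - s) * x) \<le> (1 - s) * 1"
      using small[OF that] mult_left_mono[of "norm x" 1 "1 - s"] that x by simp
    then show "s \<le> 1 - norm (of_real (1 - s) * x)" by simp
  qed
  \<comment> \<open>Comparison with the primitive \<open>M / p * s powr p\<close>. Its derivative
    may blow up at 0, but derivatives are required only in the open interval, and continuity at the
    ends.\<close>
  have "norm (F h - F 0) \<le> M / p * h powr p - M / p * 0 powr p"
  proof (rule differentiable_bound_general[where f = F
        and f' = "\<lambda>s. - x * deriv g (of_real (1 - s) * x)" and \<phi>' = "\<lambda>s. M * s powr (- (1 - p))"])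
    show "continuous_on {0..h} F" unfolding F_def
    proof (rule continuous_on_compose)
      show "continuous_on {0..h} (\<lambda>s. of_real (1 - s) * x)" by (intro continuous_intros)
      show "continuous_on ((\<lambda>s. of_real (1 - s) * x) ` {0..h}) g"
      proof (rule continuous_on_subset[OF holomorphic_on_imp_continuous_on[OF hol]])
        show "(\<lambda>s. of_real (1 - s) * x) ` {0..h} \<subseteq> ball 0 1"
          using small'(1) h by (simp add: image_subset_iff del: of_real_diff)
      qed
    qed
    show "continuous_on {0..h} (\<lambda>s. M / p * s powr p)"
      by (intro continuous_intros continuous_on_powr') (use p in auto)
  next
    fix s assume s: "0 < s" "s < h"
    then have s1: "0 \<le> s" "s \<le> 1" using h by auto
    have "((\<lambda>s. of_real (1 - s) * x) has_vector_derivative - x) (at s)"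
      by (auto intro!: derivative_eq_intros)
    moreover have "(g has_field_derivative deriv g (of_real (1 - s) * x)) (at (of_real (1 - s) * x))"
      using small'[OF s1] by (intro holomorphic_derivI[OF hol open_ball]) auto
    ultimately show "(F has_vector_derivative - x * deriv g (of_real (1 - s) * x)) (at s)"
      unfolding F_def by (rule field_vector_diff_chain_at)
    show "((\<lambda>s. M / p * s powr p) has_vector_derivative M * s powr - (1 - p)) (at s)"
      using s p by (auto intro!: derivative_eq_intros simp flip: has_real_derivative_iff_has_vector_derivative)
    have "norm (- x * deriv g (of_real (1 - s) * x)) \<le> 1 * norm (deriv g (of_real (1 - s) * x))"
      using x unfolding norm_mult norm_minus_cancel by (intro mult_right_mono) auto
    also have "\<dots> \<le> M * s powr - (1 - p)"
      using le_mult_powr_uminus[OF der[OF small'(1)[OF s1]], of s] s p small'[OF s1]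
        one_minus_square_bounds(2)[OF norm_ge_zero small'(1)[OF s1]]
      by simp
    finally show "norm (- x * deriv g (of_real (1 - s) * x)) \<le> M * s powr - (1 - p)" .
  qed (use h in auto)
  then show ?thesis using p by (simp add: F_def)
qed

text \<open>Both points are pushed radially inwards by half their distance; the segment joining
  the pushed points then stays at that distance from the boundary.\<close>

lemma hardy_littlewood_lipschitz:
  fixes g :: "complex \<Rightarrow> complex"
  assumes hol: "g holomorphic_on ball 0 1"
    and der: "\<And>z. norm z < 1 \<Longrightarrow> norm (deriv g z) * (1 - (norm z)\<^sup>2) powr (1 - p) \<le> M"
    and p: "0 < p" "p < 1" and x: "norm x < 1" and y: "norm y < 1"
  shows "norm (g x - g y) \<le> (2 / p + 2) * M * norm (x - y) powr p"
proof (cases "x = y")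
  case True
  then show ?thesis by simp
next
  case False
  define h where "h = norm (x - y) / 2"
  have h: "0 < h" "h \<le> 1"
    using False x y norm_triangle_ineq4[of x y] by (auto simp: h_def)
  have M: "0 \<le> M" using order_trans[OF _ der[of 0]] by simp
  let ?x = "of_real (1 - h) * x" and ?y = "of_real (1 - h) * y"
  \<comment> \<open>Mean value inequality on the disk of radius \<open>1 - h\<close>, which is
    convex, contains both pushed points and lies at distance \<open>h\<close> from the unit
    circle.\<close>
  have "norm (g ?x - g ?y) \<le> M * h powr (- (1 - p)) * norm (?x - ?y)"
  proof (rule field_differentiable_bound)
    show "convex (cball (0::complex) (1 - h))" by simp
    have "norm w \<le> 1 - h" if "w \<in> cball 0 (1 - h)" for w :: complex using that by simp
    then show "(g has_field_derivative deriv g w) (at w within cball 0 (1 - h))"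
      if "w \<in> cball 0 (1 - h)" for w
      using that h by (intro has_field_derivative_at_within[OF holomorphic_derivI[OF hol open_ball]])
        force
    show "norm (deriv g w) \<le> M * h powr (- (1 - p))" if "w \<in> cball 0 (1 - h)" for w
    proof -
      have w: "norm w < 1" "h \<le> 1 - norm w" using that h by auto
      show ?thesis
        using le_mult_powr_uminus[OF der[OF w(1)], of h] w h p
          one_minus_square_bounds(2)[OF norm_ge_zero w(1)] by simp
    qed
    show "?x \<in> cball 0 (1 - h)" "?y \<in> cball 0 (1 - h)"
      using h x y mult_left_mono[of "norm x" 1 "1 - h"] mult_left_mono[of "norm y" 1 "1 - h"]
      by (auto simp: norm_mult simp del: of_real_diff)
  qed
  also have "\<dots> \<le> M * h powr (- (1 - p)) * (2 * h)"
  proof (intro mult_left_mono)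
    have "norm (?x - ?y) = (1 - h) * (2 * h)"
      using h unfolding right_diff_distrib[symmetric] norm_mult norm_of_real by (simp add: h_def)
    then show "norm (?x - ?y) \<le> 2 * h" using h by simp
  qed (use M in auto)
  also have "\<dots> = 2 * M * h powr p"
    using h by (simp add: powr_diff powr_minus field_simps)
  finally have mid: "norm (g ?x - g ?y) \<le> 2 * M * h powr p" .
  \<comment> \<open>The two radial moves contribute \<open>M / p\<close> each and the middle segment
    \<open>2 * M\<close>, whence the constant; finally \<open>h\<close> is at most
    \<open>norm (x - y)\<close>.\<close>
  have "norm (g x - g y) \<le> norm (g ?x - g ?y) + norm (g ?x - g x) + norm (g ?y - g y)"
    by norm
  also have "\<dots> \<le> 2 * M * h powr p + M / p * h powr p + M / p * h powr p"
    by (intro add_mono mid radial_increment_bound[OF hol der p] x y h)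
  also have "\<dots> = (2 / p + 2) * M * h powr p" by (simp add: algebra_simps)
  also have "\<dots> \<le> (2 / p + 2) * M * norm (x - y) powr p"
    using p h M by (intro mult_left_mono powr_mono2) (auto simp: h_def)
  finally show ?thesis .
qed

section \<open>Holomorphic functions on the polydisk\<close>

lemma polydisk_iff: "z \<in> polydisk \<longleftrightarrow> (\<forall>k. norm (z $ k) < 1)"
  by (simp add: polydisk_def)

lemma norm_axis: "norm (axis k x) = norm (x :: 'a :: real_inner)"
  by (simp add: norm_eq_sqrt_inner inner_axis_axis)

text \<open>Written exactly as in \<open>partial_deriv\<close>, so that unfolding a partial
  derivative yields the derivative of a slice.\<close>

abbreviation vec_update :: "complex ^ 'n \<Rightarrow> 'n \<Rightarrow> complex \<Rightarrow> complex ^ 'n" where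
  "vec_update z k \<zeta> \<equiv> (\<chi> j. if j = k then \<zeta> else z $ j)"

lemma vec_update_triv [simp]: "vec_update z k (z $ k) = z"
  by (simp add: vec_eq_iff)

lemma vec_update_in_polydisk: "z \<in> polydisk \<Longrightarrow> norm \<zeta> < 1 \<Longrightarrow> vec_update z k \<zeta> \<in> polydisk"
  by (simp add: polydisk_iff)

lemma norm_vec_update_diff: "norm (vec_update z k x - vec_update z k y) = norm (x - y)"
proof -
  have "vec_update z k x - vec_update z k y = axis k (x - y)"
    by (simp add: vec_eq_iff axis_def)
  then show ?thesis by (simp add: norm_axis)
qed

text \<open>The slice map is affine with linear part \<open>axis k\<close>, so the chain rule gives
  the real derivative \<open>\<lambda>x. L (axis k x)\<close>. Complex linearity of \<open>L\<close>
  turns this into multiplication by \<open>L (axis k 1)\<close>.\<close>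

lemma has_field_derivative_vec_update:
  fixes F :: "complex ^ 'n \<Rightarrow> complex"
  assumes L: "Vector_Spaces.linear (*s) (*) L" and F: "(F has_derivative L) (at (vec_update z k \<zeta>))"
  shows "((\<lambda>\<zeta>. F (vec_update z k \<zeta>)) has_field_derivative L (axis k 1)) (at \<zeta>)"
proof -
  have eq: "vec_update z k = (\<lambda>\<zeta>. vec_update z k 0 + axis k \<zeta>)"
    by (rule ext) (simp add: vec_eq_iff axis_def)
  have "bounded_linear (axis k :: complex \<Rightarrow> complex ^ 'n)"
    by (rule bounded_linear_intro[of _ 1]) (simp_all add: norm_axis, simp_all add: vec_eq_iff axis_def)
  then have "((\<lambda>\<zeta>. vec_update z k 0 + axis k \<zeta>) has_derivative (\<lambda>h. 0 + axis k h)) (at \<zeta>)"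
    by (intro has_derivative_add has_derivative_const bounded_linear_imp_has_derivative)
  then have "(vec_update z k has_derivative axis k) (at \<zeta>)"
    by (subst eq) simp
  from has_derivative_compose[OF this F]
  have "((\<lambda>\<zeta>. F (vec_update z k \<zeta>)) has_derivative (\<lambda>x. L (axis k x))) (at \<zeta>)" .
  moreover have "L (axis k x) = L (axis k 1) * x" for x
  proof -
    interpret L: Vector_Spaces.linear "(*s)" "(*)" L by (rule L)
    have "L (axis k x) = L (x *s axis k 1)"
      by (rule arg_cong[of _ _ L]) (simp add: vec_eq_iff axis_def)
    then show ?thesis by (simp add: L.scale mult.commute)
  qed
  then have "(\<lambda>x. L (axis k x)) = (*) (L (axis k 1))" by (rule ext)
  ultimately show ?thesis unfolding has_field_derivative_def by (simp only:)
qed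

lemma partial_deriv_eq:
  fixes F :: "complex ^ 'n \<Rightarrow> complex"
  assumes "Vector_Spaces.linear (*s) (*) L" "(F has_derivative L) (at z)"
  shows "partial_deriv k F z = L (axis k 1)"
  unfolding partial_deriv_def
proof (rule DERIV_imp_deriv)
  show "((\<lambda>\<zeta>. F (vec_update z k \<zeta>)) has_field_derivative L (axis k 1)) (at (z $ k))"
    by (rule has_field_derivative_vec_update[OF assms(1)]) (simp only: vec_update_triv assms(2))
qed

lemma slice_holomorphic:
  assumes "holomorphic_Cn_on f polydisk" "z \<in> polydisk"
  shows "(\<lambda>\<zeta>. f (vec_update z k \<zeta>)) holomorphic_on ball 0 1"
proof -
  have "\<exists>D. ((\<lambda>\<zeta>. f (vec_update z k \<zeta>)) has_field_derivative D) (at \<zeta>)" if "\<zeta> \<in> ball 0 1" for \<zeta>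
  proof -
    have "vec_update z k \<zeta> \<in> polydisk" using assms(2) that by (intro vec_update_in_polydisk) auto
    with assms(1) show ?thesis
      unfolding holomorphic_Cn_on_def by (blast intro: has_field_derivative_vec_update)
  qed
  then show ?thesis by (auto simp: holomorphic_on_open)
qed

text \<open>A second update of coordinate \<open>k\<close> overwrites the first, so the slices
  through \<open>z\<close> and through the updated point are the same function.\<close>

lemma deriv_slice: "deriv (\<lambda>\<zeta>. f (vec_update z k \<zeta>)) \<zeta> = partial_deriv k f (vec_update z k \<zeta>)"
proof -
  have "(\<chi> j. if j = k then \<xi> else vec_update z k \<zeta> $ j) = vec_update z k \<xi>" for \<xi>
    by (simp add: vec_eq_iff)
  then show ?thesis by (simp add: partial_deriv_def)
qed

text \<open>The one-variable estimate on the slice through \<open>z\<close>. A slice is an isometric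
  embedding of the disk, so the Lipschitz constant carries over and no dimension factor
  enters.\<close>

lemma partial_deriv_bound:
  fixes f :: "complex ^ 'n \<Rightarrow> complex"
  assumes hol: "holomorphic_Cn_on f polydisk"
    and lip: "\<And>z w. z \<in> polydisk \<Longrightarrow> w \<in> polydisk \<Longrightarrow> norm (f z - f w) \<le> M * norm (z - w) powr p"
    and p: "0 < p" "p < 1" and z: "z \<in> polydisk"
  shows "norm (partial_deriv k f z) * (1 - (norm (z $ k))\<^sup>2) powr (1 - p) \<le> 4 * M"
proof -
  have "norm (deriv (\<lambda>\<zeta>. f (vec_update z k \<zeta>)) (z $ k)) * (1 - (norm (z $ k))\<^sup>2) powr (1 - p) \<le> 4 * M"
  proof (rule hardy_littlewood_deriv_bound[OF slice_holomorphic[OF hol z] _ p])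
    show "norm (f (vec_update z k x) - f (vec_update z k y)) \<le> M * norm (x - y) powr p"
      if "x \<in> ball 0 1" "y \<in> ball 0 1" for x y
      using lip[of "vec_update z k x" "vec_update z k y"] vec_update_in_polydisk[OF z] that
      by (simp add: norm_vec_update_diff)
  qed (use z in \<open>auto simp: polydisk_iff\<close>)
  then show ?thesis by (simp add: deriv_slice)
qed

text \<open>The passage from \<open>z\<close> to \<open>w\<close> changes one coordinate at a time;
  every step is a one-variable increment along a slice, and there are \<open>CARD('n)\<close> of
  them.\<close>

lemma lipschitz_of_partial_deriv_bound:
  fixes f :: "complex ^ 'n \<Rightarrow> complex"
  assumes hol: "holomorphic_Cn_on f polydisk"
    and der: "\<And>z k. z \<in> polydisk \<Longrightarrow>
      norm (partial_deriv k f z) * (1 - (norm (z $ k))\<^sup>2) powr (1 - p) \<le> M"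
    and p: "0 < p" "p < 1" and z: "z \<in> polydisk" and w: "w \<in> polydisk"
  shows "norm (f z - f w) \<le> real CARD('n) * (2 / p + 2) * M * norm (z - w) powr p"
proof -
  \<comment> \<open>Hybrid point with the coordinates in \<open>S\<close> already moved to
    \<open>w\<close>. The polydisk is a product, so all hybrids lie in it.\<close>
  define mix where "mix S = (\<chi> j. if j \<in> S then w $ j else z $ j)" for S
  define c where "c = (2 / p + 2) * M * norm (z - w) powr p"
  have M: "0 \<le> M" using der[of 0] by (rule order_trans[rotated]) (auto simp: polydisk_iff)
  have mix: "mix S \<in> polydisk" for S using z w by (simp add: mix_def polydisk_iff)
  have "norm (f z - f (mix S)) \<le> real (card S) * c" for S :: "'n set"
  proof (induction S rule: finite_induct[OF finite])
    case 1
    have "mix {} = z" by (simp add: mix_def)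
    then show ?case by simp
  next
    case (2 k S)
    let ?u = "mix S"
    have upd: "vec_update ?u k (z $ k) = ?u" "vec_update ?u k (w $ k) = mix (insert k S)"
      using 2 by (auto simp: mix_def vec_eq_iff)
    have "norm (f (vec_update ?u k (z $ k)) - f (vec_update ?u k (w $ k)))
        \<le> (2 / p + 2) * M * norm (z $ k - w $ k) powr p"
    proof (rule hardy_littlewood_lipschitz[OF slice_holomorphic[OF hol mix] _ p])
      show "norm (deriv (\<lambda>\<zeta>. f (vec_update ?u k \<zeta>)) x) * (1 - (norm x)\<^sup>2) powr (1 - p) \<le> M"
        if "norm x < 1" for x
        using der[of "vec_update ?u k x" k] vec_update_in_polydisk[OF mix that]
        by (simp add: deriv_slice)
    qed (use z w in \<open>auto simp: polydisk_iff\<close>)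
    also have "\<dots> \<le> c"
      unfolding c_def using M p Finite_Cartesian_Product.norm_nth_le[of "z - w" k]
      by (intro mult_left_mono powr_mono2) auto
    finally have "norm (f ?u - f (mix (insert k S))) \<le> c" unfolding upd .
    moreover have "norm (f z - f (mix (insert k S)))
        \<le> norm (f z - f ?u) + norm (f ?u - f (mix (insert k S)))" by norm
    ultimately have "norm (f z - f (mix (insert k S))) \<le> real (card S) * c + c"
      using 2 by linarith
    then show ?case using 2 by (simp add: algebra_simps)
  qed
  from this[of UNIV] show ?thesis by (simp add: mix_def c_def algebra_simps)
qed

lemma composition_partial_deriv:
  fixes f :: "complex ^ 'm \<Rightarrow> complex" and \<phi> :: "complex ^ 'n \<Rightarrow> complex ^ 'm"
  assumes f: "holomorphic_Cn_on f T" and \<phi>: "holomorphic_map_Cn_on \<phi> S" and sub: "\<phi> ` S \<subseteq> T"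
  shows "holomorphic_Cn_on (f \<circ> \<phi>) S"
    and "z \<in> S \<Longrightarrow> partial_deriv k (f \<circ> \<phi>) z =
      (\<Sum>l\<in>UNIV. partial_deriv l f (\<phi> z) * partial_deriv k (\<lambda>w. \<phi> w $ l) z)"
proof -
  \<comment> \<open>A single derivative serves both claims: its complex linearity is holomorphy, its
    values on the standard basis are the partial derivatives.\<close>
  have main: "\<exists>L. Vector_Spaces.linear (*s) (*) L \<and> ((f \<circ> \<phi>) has_derivative L) (at z) \<and>
      (\<forall>k. L (axis k 1) = (\<Sum>l\<in>UNIV. partial_deriv l f (\<phi> z) * partial_deriv k (\<lambda>w. \<phi> w $ l) z))"
    if z: "z \<in> S" for z
  proof -
    have "\<forall>l. \<exists>L. Vector_Spaces.linear (*s) (*) L \<and> ((\<lambda>w. \<phi> w $ l) has_derivative L) (at z)"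
      using \<phi> z unfolding holomorphic_map_Cn_on_def holomorphic_Cn_on_def by blast
    from choice[OF this] obtain D where D: "\<And>l. Vector_Spaces.linear (*s) (*) (D l)"
      "\<And>l. ((\<lambda>w. \<phi> w $ l) has_derivative D l) (at z)"
      by blast
    obtain E where E: "Vector_Spaces.linear (*s) (*) E" "(f has_derivative E) (at (\<phi> z))"
      using f z sub unfolding holomorphic_Cn_on_def by blast
    have E_sum: "E v = (\<Sum>l\<in>UNIV. E (axis l 1) * v $ l)" for v
    proof -
      interpret E: Vector_Spaces.linear "(*s)" "(*)" E by (rule E(1))
      have "E v = E (\<Sum>l\<in>UNIV. v $ l *s axis l 1)" by (simp only: basis_expansion)
      also have "\<dots> = (\<Sum>l\<in>UNIV. E (axis l 1) * v $ l)"
        by (simp add: E.sum E.scale mult.commute)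
      finally show ?thesis .
    qed
    have "(\<phi> has_derivative (\<lambda>h. \<chi> l. D l h)) (at z)"
    proof (subst has_derivative_componentwise_within, intro ballI)
      fix b :: "complex ^ 'm" assume "b \<in> Basis"
      then obtain l u where b: "b = axis l u" by (auto simp: Basis_vec_def)
      show "((\<lambda>x. \<phi> x \<bullet> b) has_derivative (\<lambda>x. (\<chi> l. D l x) \<bullet> b)) (at z)"
        unfolding b inner_axis by (auto intro!: derivative_eq_intros D(2))
    qed
    from diff_chain_at[OF this E(2)]
    have "((f \<circ> \<phi>) has_derivative (\<lambda>h. E (\<chi> l. D l h))) (at z)" by (simp add: o_def)
    moreover have "Vector_Spaces.linear (*s) (*) (\<lambda>h. E (\<chi> l. D l h))"
    proof -
      have add: "D l (x + y) = D l x + D l y" and scale: "D l (r *s x) = r * D l x" for l x y r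
        using D(1)[of l] by (auto simp: Vector_Spaces.linear_iff)
      have "(\<chi> l. D l x + D l y) = (\<chi> l. D l x) + (\<chi> l. D l y)"
        "(\<chi> l. r * D l x) = r *s (\<chi> l. D l x)" for x y r
        by (simp_all add: vec_eq_iff)
      \<comment> \<open>Any component \<open>D l\<close> will do: it supplies the vector space laws
        of the domain contained in \<open>Vector_Spaces.linear_iff\<close>.\<close>
      with E(1) D(1)[of undefined] show ?thesis
        by (auto simp: Vector_Spaces.linear_iff add scale)
    qed
    moreover have "E (\<chi> l. D l (axis k 1)) =
        (\<Sum>l\<in>UNIV. partial_deriv l f (\<phi> z) * partial_deriv k (\<lambda>w. \<phi> w $ l) z)" for k
      by (subst E_sum) (simp add: partial_deriv_eq[OF E] partial_deriv_eq[OF D])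
    ultimately show ?thesis by (intro exI conjI allI)
  qed
  show "holomorphic_Cn_on (f \<circ> \<phi>) S"
    unfolding holomorphic_Cn_on_def using main by blast
  show "partial_deriv k (f \<circ> \<phi>) z =
      (\<Sum>l\<in>UNIV. partial_deriv l f (\<phi> z) * partial_deriv k (\<lambda>w. \<phi> w $ l) z)" if "z \<in> S"
    using main[OF that] partial_deriv_eq by metis
qed

lemma coordinate_function_holomorphic:
  fixes l :: "'n::finite"
  assumes "g holomorphic_on ball 0 1"
  shows "holomorphic_Cn_on (\<lambda>w :: complex ^ 'n. g (w $ l)) polydisk"
  unfolding holomorphic_Cn_on_def
proof
  fix z :: "complex ^ 'n" assume "z \<in> polydisk"
  then have "(g has_derivative (*) (deriv g (z $ l))) (at (z $ l))"
    using holomorphic_derivI[OF assms open_ball, of "z $ l" UNIV]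
    by (auto simp: polydisk_iff has_field_derivative_def)
  moreover have "((\<lambda>w. w $ l) has_derivative (\<lambda>h. h $ l)) (at z)"
    by (intro bounded_linear_imp_has_derivative bounded_linear_vec_nth)
  ultimately have "((\<lambda>w. g (w $ l)) has_derivative (\<lambda>h. deriv g (z $ l) * h $ l)) (at z)"
    by (rule has_derivative_compose[rotated])
  moreover have "Vector_Spaces.linear (*s) (*) (\<lambda>h :: complex ^ 'n. deriv g (z $ l) * h $ l)"
    by (unfold_locales) (auto simp: algebra_simps)
  ultimately show "\<exists>L. Vector_Spaces.linear (*s) (*) L \<and> ((\<lambda>w. g (w $ l)) has_derivative L) (at z)"
    by blast
qed

lemma partial_deriv_coordinate_function:
  "partial_deriv k (\<lambda>w. g (w $ l)) z = (if k = l then deriv g (z $ l) else 0)"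
  by (simp add: partial_deriv_def)

section \<open>Lipschitz spaces\<close>

lemma lip_quotients_le:
  assumes "\<And>z w. z \<in> polydisk \<Longrightarrow> w \<in> polydisk \<Longrightarrow> norm (f z - f w) \<le> M * norm (z - w) powr p"
    and "x \<in> lip_quotients p f"
  shows "x \<le> M"
  using assms by (auto simp: lip_quotients_def divide_le_eq)

text \<open>Needed to bound \<open>Sup\<close> from above and to find it nonnegative. As the index
  type is nonempty, 0 and the constant vector 1/2 are distinct.\<close>

lemma lip_quotients_nonempty: "lip_quotients p (f :: complex ^ 'n \<Rightarrow> complex) \<noteq> {}"
proof -
  have "(0 :: complex ^ 'n) \<in> polydisk" "(\<chi> j. (1/2 :: complex)) \<in> (polydisk :: (complex ^ 'n) set)"
    "(0 :: complex ^ 'n) \<noteq> (\<chi> j. 1/2)"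
    by (auto simp: polydisk_iff vec_eq_iff)
  then show ?thesis unfolding lip_quotients_def by blast
qed

lemma lip_spaceI:
  assumes "holomorphic_Cn_on f polydisk"
    and "\<And>z w. z \<in> polydisk \<Longrightarrow> w \<in> polydisk \<Longrightarrow> norm (f z - f w) \<le> M * norm (z - w) powr p"
  shows "f \<in> lip_space p" "lip_norm p f \<le> norm (f 0) + M"
  using assms(1) lip_quotients_le[OF assms(2)] cSup_least[OF lip_quotients_nonempty[of p f], of M]
  by (auto simp: lip_space_def lip_norm_def intro: bdd_aboveI[of _ M])

lemma Sup_lip_quotients_nonneg:
  assumes "f \<in> lip_space p"
  shows "0 \<le> Sup (lip_quotients p f)"
proof -
  obtain x where x: "x \<in> lip_quotients p f" using lip_quotients_nonempty by blast
  then have "0 \<le> x" by (auto simp: lip_quotients_def)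
  also have "x \<le> Sup (lip_quotients p f)"
    using assms x by (intro cSup_upper) (auto simp: lip_space_def)
  finally show ?thesis .
qed

lemma lip_space_dist_le:
  assumes "f \<in> lip_space p" "z \<in> polydisk" "w \<in> polydisk"
  shows "norm (f z - f w) \<le> Sup (lip_quotients p f) * norm (z - w) powr p"
proof (cases "z = w")
  case False
  then have "norm (f z - f w) / norm (z - w) powr p \<in> lip_quotients p f"
    using assms unfolding lip_quotients_def by blast
  then have "norm (f z - f w) / norm (z - w) powr p \<le> Sup (lip_quotients p f)"
    using assms(1) by (intro cSup_upper) (auto simp: lip_space_def)
  then show ?thesis using False by (simp add: divide_le_eq)
qed auto

section \<open>The test functions\<close>

text \<open>As \<open>norm u = 1\<close>, the base \<open>1 - cnj u * w\<close> has real part at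
  least \<open>1 - norm w\<close>; this keeps it off the cut of the principal power and bounds the
  derivative, whose modulus is \<open>p * norm (1 - cnj u * w) powr (p - 1)\<close>.\<close>

lemma power_test_function:
  fixes u :: complex
  assumes u: "norm u = 1" and p: "0 < p" "p < 1"
  defines "g \<equiv> \<lambda>w. (1 - cnj u * w) powr of_real p"
  shows "g holomorphic_on ball 0 1"
    and "norm w < 1 \<Longrightarrow> norm (deriv g w) * (1 - (norm w)\<^sup>2) powr (1 - p) \<le> 2 * p"
    and "0 \<le> r \<Longrightarrow> r < 1 \<Longrightarrow> p \<le> norm (deriv g (of_real r * u)) * (1 - r\<^sup>2) powr (1 - p)"
proof -
  have far: "1 - norm w \<le> Re (1 - cnj u * w)" for w
    using complex_Re_le_cmod[of "cnj u * w"] u by (simp add: norm_mult)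
  have nonpos: "1 - cnj u * w \<notin> \<real>\<^sub>\<le>\<^sub>0" if "norm w < 1" for w
    using far[of w] that complex_nonpos_Reals_iff by force
  have der: "(g has_field_derivative
      of_real p * (1 - cnj u * w) powr (of_real p - 1) * (- cnj u)) (at w)" if "norm w < 1" for w
    unfolding g_def using nonpos[OF that]
    by (auto intro!: derivative_eq_intros DERIV_chain2[OF has_field_derivative_powr])
  show "g holomorphic_on ball 0 1"
    using der unfolding holomorphic_on_open[OF open_ball] by (metis mem_ball_0)
  have ndv: "norm (deriv g w) = p * norm (1 - cnj u * w) powr - (1 - p)" if "norm w < 1" for w
    using DERIV_imp_deriv[OF der[OF that]] p u norm_powr_real_powr'[of "of_real p - 1" "1 - cnj u * w"]
    by (simp add: norm_mult)
  show "norm (deriv g w) * (1 - (norm w)\<^sup>2) powr (1 - p) \<le> 2 * p" if w: "norm w < 1"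
  proof -
    note b = one_minus_square_bounds[OF norm_ge_zero w]
    let ?a = "norm (1 - cnj u * w)"
    have a: "1 - norm w \<le> ?a" using far[of w] complex_Re_le_cmod order_trans by blast
    then have "(1 - (norm w)\<^sup>2) powr (1 - p) \<le> (2 * ?a) powr (1 - p)"
      using p b w by (intro powr_mono2) auto
    then have "norm (deriv g w) * (1 - (norm w)\<^sup>2) powr (1 - p)
        \<le> p * ?a powr - (1 - p) * (2 * ?a) powr (1 - p)"
      unfolding ndv[OF w] using p by (intro mult_left_mono) auto
    also have "\<dots> = p * 2 powr (1 - p) * (?a powr - (1 - p) * ?a powr (1 - p))"
      by (simp add: powr_mult)
    also have "?a powr - (1 - p) * ?a powr (1 - p) = 1"
      using a w by (intro powr_uminus_mult_powr) linarith
    also have "p * 2 powr (1 - p) * 1 \<le> p * 2 powr 1"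
      unfolding mult_1_right using p by (intro mult_left_mono powr_mono) auto
    finally show ?thesis by simp
  qed
  show "p \<le> norm (deriv g (of_real r * u)) * (1 - r\<^sup>2) powr (1 - p)" if r: "0 \<le> r" "r < 1"
  proof -
    \<comment> \<open>On the radius towards \<open>u\<close> the base is the real number
      \<open>1 - r\<close>, exactly the distance to the boundary, so the upper estimate is sharp up
      to a constant.\<close>
    have "cnj u * (of_real r * u) = of_real r * (u * cnj u)" by (simp only: mult_ac)
    also have "\<dots> = of_real r" using u by (simp add: complex_norm_square[symmetric])
    finally have "1 - cnj u * (of_real r * u) = of_real (1 - r)" by simp
    then have "norm (1 - cnj u * (of_real r * u)) = 1 - r"
      using r by (simp only: norm_of_real)
    then have n: "norm (deriv g (of_real r * u)) = p * (1 - r) powr - (1 - p)"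
      using ndv[of "of_real r * u"] r u by (simp add: norm_mult)
    have "(1 - r) powr (1 - p) \<le> (1 - r\<^sup>2) powr (1 - p)"
      using r p one_minus_square_bounds(2)[OF r] by (intro powr_mono2) auto
    then have "p * (1 - r) powr - (1 - p) * (1 - r) powr (1 - p)
        \<le> norm (deriv g (of_real r * u)) * (1 - r\<^sup>2) powr (1 - p)"
      unfolding n using p by (intro mult_left_mono) auto
    then show ?thesis using r powr_uminus_mult_powr[of "1 - r" "1 - p"] by (simp add: mult.assoc)
  qed
qed

section \<open>Composition operators\<close>

text \<open>If \<open>f\<close> has Lipschitz constant \<open>S\<close>, its derivative in direction
  \<open>l\<close> at \<open>\<phi> z\<close> is at most \<open>4 * S\<close> over the weight of
  \<open>\<phi> z $ l\<close>. The chain rule then leaves the sum bounded by \<open>C\<close>, and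
  Hardy-Littlewood for \<open>q\<close> leads back to a Lipschitz bound.\<close>

lemma bounded_operator_of_weight_bound:
  fixes \<phi> :: "complex ^ 'n \<Rightarrow> complex ^ 'n"
  assumes hol: "holomorphic_map_Cn_on \<phi> polydisk" and self: "\<phi> ` polydisk \<subseteq> polydisk"
    and pq: "0 < p" "p < 1" "0 < q" "q < 1" and C: "0 \<le> C"
    and bound: "\<And>z k. z \<in> polydisk \<Longrightarrow>
      (\<Sum>l\<in>UNIV. norm (partial_deriv k (\<lambda>w. \<phi> w $ l) z) *
        ((1 - (norm (z $ k))\<^sup>2) powr (1 - q) / (1 - (norm (\<phi> z $ l))\<^sup>2) powr (1 - p))) \<le> C"
  shows "bounded_operator (lip_space p) (lip_norm p) (lip_space q) (lip_norm q) (composition_op \<phi>)"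
proof -
  define A where "A = real CARD('n) * (2 / q + 2) * (4 * C)"
  \<comment> \<open>The terms pay for \<open>norm (f 0)\<close>, for moving the evaluation point
    from 0 to \<open>\<phi> 0\<close>, and for the Lipschitz seminorm of the image.\<close>
  define K where "K = 1 + norm (\<phi> 0) powr p + A"
  have A: "0 \<le> A" using C pq by (simp add: A_def)
  have zero: "(0 :: complex ^ 'n) \<in> polydisk" by (simp add: polydisk_iff)
  have main: "composition_op \<phi> f \<in> lip_space q \<and> lip_norm q (composition_op \<phi> f) \<le> K * lip_norm p f"
    if f: "f \<in> lip_space p" for f
  proof -
    define S where "S = Sup (lip_quotients p f)"
    have S: "0 \<le> S" unfolding S_def by (rule Sup_lip_quotients_nonneg[OF f])
    have f_hol: "holomorphic_Cn_on f polydisk" using f by (simp add: lip_space_def)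
    note f_lip = lip_space_dist_le[OF f, folded S_def]
    note comp = composition_partial_deriv[OF f_hol hol self]
    have "norm (partial_deriv k (f \<circ> \<phi>) z) * (1 - (norm (z $ k))\<^sup>2) powr (1 - q) \<le> 4 * S * C"
      if z: "z \<in> polydisk" for z k
    proof -
      have \<phi>z: "\<phi> z \<in> polydisk" using self z by blast
      define W where "W l = (1 - (norm (\<phi> z $ l))\<^sup>2) powr (1 - p)" for l
      define V where "V = (1 - (norm (z $ k))\<^sup>2) powr (1 - q)"
      have W: "0 < W l" for l
        using \<phi>z one_minus_square_bounds(1)[of "norm (\<phi> z $ l)"] by (simp add: W_def polydisk_iff)
      have df: "norm (partial_deriv l f (\<phi> z)) \<le> 4 * S / W l" for l
        using partial_deriv_bound[OF f_hol f_lip pq(1,2) \<phi>z, of l] W[of l]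
        by (simp add: W_def pos_le_divide_eq)
      have "norm (partial_deriv k (f \<circ> \<phi>) z) * V
          \<le> (\<Sum>l\<in>UNIV. norm (partial_deriv l f (\<phi> z)) * norm (partial_deriv k (\<lambda>w. \<phi> w $ l) z)) * V"
        unfolding comp(2)[OF z] norm_mult[symmetric]
        by (intro mult_right_mono norm_sum) (simp add: V_def)
      also have "\<dots> \<le> (\<Sum>l\<in>UNIV. 4 * S / W l * norm (partial_deriv k (\<lambda>w. \<phi> w $ l) z)) * V"
        by (intro mult_right_mono sum_mono df) (auto simp: V_def)
      also have "\<dots> = 4 * S * (\<Sum>l\<in>UNIV. norm (partial_deriv k (\<lambda>w. \<phi> w $ l) z) * (V / W l))"
        by (simp add: sum_distrib_left sum_distrib_right mult_ac)
      also have "\<dots> \<le> 4 * S * C"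
        using bound[OF z, of k] S by (intro mult_left_mono) (auto simp: V_def W_def)
      finally show ?thesis by (simp add: V_def)
    qed
    from lipschitz_of_partial_deriv_bound[OF comp(1) this pq(3,4)]
    have "norm ((f \<circ> \<phi>) z - (f \<circ> \<phi>) w) \<le> A * S * norm (z - w) powr q"
      if "z \<in> polydisk" "w \<in> polydisk" for z w
      using that by (simp add: A_def mult_ac)
    from lip_spaceI[where f = "f \<circ> \<phi>", OF comp(1) this]
    have L: "f \<circ> \<phi> \<in> lip_space q" "lip_norm q (f \<circ> \<phi>) \<le> norm (f (\<phi> 0)) + A * S"
      by (simp_all only: o_apply)
    have "norm (f (\<phi> 0)) \<le> norm (f 0) + norm (f (\<phi> 0) - f 0)" by norm
    also have "norm (f (\<phi> 0) - f 0) \<le> S * norm (\<phi> 0) powr p"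
      using f_lip[of "\<phi> 0" 0] self zero by auto
    finally have "lip_norm q (f \<circ> \<phi>) \<le> norm (f 0) + S * norm (\<phi> 0) powr p + A * S"
      using L(2) by linarith
    also have "\<dots> \<le> K * norm (f 0) + K * S"
    proof -
      have "1 * norm (f 0) \<le> K * norm (f 0)" "(norm (\<phi> 0) powr p + A) * S \<le> K * S"
        using A S by (intro mult_right_mono; simp add: K_def)+
      then show ?thesis by (simp add: algebra_simps)
    qed
    finally show ?thesis using L(1)
      by (simp add: composition_op_def lip_norm_def S_def algebra_simps)
  qed
  then show ?thesis unfolding bounded_operator_def by blast
qed

text \<open>For every \<open>z\<close> and \<open>l\<close> the operator is tested on a function
  adapted to them. Its norm is bounded independently of both, so the derivative bound for its image
  gives a uniform \<open>B\<close>, one summand at a time.\<close>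

lemma weight_bound_of_bounded_operator:
  fixes \<phi> :: "complex ^ 'n \<Rightarrow> complex ^ 'n"
  assumes hol: "holomorphic_map_Cn_on \<phi> polydisk" and self: "\<phi> ` polydisk \<subseteq> polydisk"
    and pq: "0 < p" "p < 1" "0 < q" "q < 1"
    and bdd: "bounded_operator (lip_space p) (lip_norm p) (lip_space q) (lip_norm q) (composition_op \<phi>)"
  obtains B where "0 \<le> B"
    "\<And>z k l. z \<in> polydisk \<Longrightarrow> norm (partial_deriv k (\<lambda>w. \<phi> w $ l) z) *
      ((1 - (norm (z $ k))\<^sup>2) powr (1 - q) / (1 - (norm (\<phi> z $ l))\<^sup>2) powr (1 - p)) \<le> B"
proof -
  obtain K0 where K0: "\<And>f. f \<in> lip_space p \<Longrightarrow> composition_op \<phi> f \<in> lip_space q"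
    "\<And>f. f \<in> lip_space p \<Longrightarrow> lip_norm q (composition_op \<phi> f) \<le> K0 * lip_norm p f"
    using bdd unfolding bounded_operator_def by blast
  \<comment> \<open>Lipschitz constant of the test functions, from their derivative bound
    \<open>2 * p\<close>; their value at 0 is 1, so \<open>1 + c\<close> bounds their norms. The
    absolute value below is there because \<open>K0\<close> is not known to be nonnegative.\<close>
  define c where "c = real CARD('n) * (2 / p + 2) * (2 * p)"
  define K where "K = \<bar>K0\<bar> * (1 + c)"
  have c: "0 \<le> c" using pq by (simp add: c_def)
  have "norm (partial_deriv k (\<lambda>w. \<phi> w $ l) z) *
      ((1 - (norm (z $ k))\<^sup>2) powr (1 - q) / (1 - (norm (\<phi> z $ l))\<^sup>2) powr (1 - p)) \<le> 4 * K / p"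
    if z: "z \<in> polydisk" for z k l
  proof -
    define a where "a = \<phi> z $ l"
    \<comment> \<open>Direction of \<open>a\<close>; at \<open>a = 0\<close> every unit number
      serves and 1 is taken.\<close>
    define u where "u = (if a = 0 then 1 else sgn a)"
    have u: "norm u = 1" by (simp add: u_def norm_sgn)
    have a_u: "of_real (norm a) * u = a" by (simp add: u_def sgn_eq)
    have "\<phi> z \<in> polydisk" using self z by blast
    then have a: "norm a < 1" by (simp add: a_def polydisk_iff)
    define g where "g = (\<lambda>w. (1 - cnj u * w) powr of_real p)"
    note test = power_test_function[OF u pq(1,2), folded g_def]
    define f where "f = (\<lambda>w :: complex ^ 'n. g (w $ l))"
    have f_hol: "holomorphic_Cn_on f polydisk"
      unfolding f_def by (rule coordinate_function_holomorphic[OF test(1)])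
    have df: "partial_deriv m f w = (if m = l then deriv g (w $ l) else 0)" for m w
      unfolding f_def by (rule partial_deriv_coordinate_function)
    have "norm (partial_deriv m f w) * (1 - (norm (w $ m))\<^sup>2) powr (1 - p) \<le> 2 * p"
      if "w \<in> polydisk" for w m
      using test(2)[of "w $ l"] that pq by (auto simp: df polydisk_iff)
    note L = lip_spaceI[OF f_hol lipschitz_of_partial_deriv_bound[OF f_hol this pq(1,2)], folded c_def]
    have "lip_norm p f \<le> 1 + c" using L(2) by (simp add: f_def g_def)
    moreover have "0 \<le> lip_norm p f"
      using Sup_lip_quotients_nonneg[OF L(1)] by (simp add: lip_norm_def)
    ultimately have "K0 * lip_norm p f \<le> K"
      unfolding K_def by (intro mult_mono) auto
    then have "lip_norm q (f \<circ> \<phi>) \<le> K"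
      using K0(2)[OF L(1)] by (simp add: composition_op_def)
    then have S: "Sup (lip_quotients q (f \<circ> \<phi>)) \<le> K"
      by (simp add: lip_norm_def) (smt (verit) norm_ge_zero)
    have f\<phi>: "f \<circ> \<phi> \<in> lip_space q" using K0(1)[OF L(1)] by (simp add: composition_op_def)
    note comp = composition_partial_deriv[OF f_hol hol self]
    define V where "V = (1 - (norm (z $ k))\<^sup>2) powr (1 - q)"
    define W where "W = (1 - (norm a)\<^sup>2) powr (1 - p)"
    define D where "D = norm (partial_deriv k (\<lambda>w. \<phi> w $ l) z)"
    have W: "0 < W" using a one_minus_square_bounds(1)[of "norm a"] by (simp add: W_def)
    \<comment> \<open>The test function depends on coordinate \<open>l\<close> alone, so one term of
      the chain rule survives, isolating a single summand of the weight condition.\<close>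
    have "partial_deriv k (f \<circ> \<phi>) z = deriv g a * partial_deriv k (\<lambda>w. \<phi> w $ l) z"
      unfolding comp(2)[OF z] df a_def by (simp add: if_distrib if_distribR sum.delta cong: if_cong)
    moreover have "norm (partial_deriv k (f \<circ> \<phi>) z) * V \<le> 4 * Sup (lip_quotients q (f \<circ> \<phi>))"
      unfolding V_def by (rule partial_deriv_bound[OF comp(1) lip_space_dist_le[OF f\<phi>] pq(3,4) z])
    ultimately have le: "norm (deriv g a) * D * V \<le> 4 * K"
      using S by (simp add: norm_mult D_def)
    have "p \<le> norm (deriv g a) * W"
      using test(3)[of "norm a"] a by (simp add: a_u W_def)
    \<comment> \<open>Multiplying by \<open>D * V / W\<close> cancels \<open>W\<close> and leaves
      the quantity already bounded by \<open>4 * K\<close>.\<close>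
    then have "p * (D * V / W) \<le> (norm (deriv g a) * W) * (D * V / W)"
      using W by (intro mult_right_mono) (auto simp: D_def V_def)
    also have "\<dots> \<le> 4 * K" using le W by simp
    finally show ?thesis
      using pq by (simp add: D_def V_def W_def a_def field_simps)
  qed
  moreover have "0 \<le> 4 * K / p" using c pq by (simp add: K_def)
  ultimately show ?thesis using that by blast
qed

theorem corollary3p2:
  fixes \<phi> :: "complex ^ 'n \<Rightarrow> complex ^ 'n" and p q :: real
  assumes "holomorphic_map_Cn_on \<phi> polydisk"
    and "\<phi> ` polydisk \<subseteq> polydisk"
    and "0 < p" "p < 1" "0 < q" "q < 1"
  shows "bounded_operator (lip_space p) (lip_norm p) (lip_space q) (lip_norm q)
           (composition_op \<phi>) \<longleftrightarrow>
         (\<exists>C\<ge>0. \<forall>z\<in>polydisk.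
            (\<Sum>k\<in>UNIV. \<Sum>l\<in>UNIV.
               norm (partial_deriv k (\<lambda>w. \<phi> w $ l) z) *
               ((1 - (norm (z $ k))\<^sup>2) powr (1 - q) /
                (1 - (norm (\<phi> z $ l))\<^sup>2) powr (1 - p))) \<le> C)"
    (is "?bdd \<longleftrightarrow> (\<exists>C\<ge>0. \<forall>z\<in>polydisk. (\<Sum>k\<in>UNIV. \<Sum>l\<in>UNIV. ?t z k l) \<le> C)")
proof
  assume ?bdd
  then obtain B where B: "0 \<le> B" "\<And>z k l. z \<in> polydisk \<Longrightarrow> ?t z k l \<le> B"
    using weight_bound_of_bounded_operator[OF assms] by blast
  have "(\<Sum>k\<in>UNIV. \<Sum>l\<in>UNIV. ?t z k l) \<le> (\<Sum>k\<in>(UNIV :: 'n set). \<Sum>l\<in>(UNIV :: 'n set). B)"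
    if "z \<in> polydisk" for z
    by (intro sum_mono B(2) that)
  moreover have "0 \<le> (\<Sum>k\<in>(UNIV :: 'n set). \<Sum>l\<in>(UNIV :: 'n set). B)"
    using B(1) by (intro sum_nonneg)
  ultimately show "\<exists>C\<ge>0. \<forall>z\<in>polydisk. (\<Sum>k\<in>UNIV. \<Sum>l\<in>UNIV. ?t z k l) \<le> C" by blast
next
  assume "\<exists>C\<ge>0. \<forall>z\<in>polydisk. (\<Sum>k\<in>UNIV. \<Sum>l\<in>UNIV. ?t z k l) \<le> C"
  then obtain C where C: "0 \<le> C"
    "\<And>z. z \<in> polydisk \<Longrightarrow> (\<Sum>k\<in>UNIV. \<Sum>l\<in>UNIV. ?t z k l) \<le> C" by blast
  \<comment> \<open>All terms are nonnegative, so the part belonging to one \<open>k\<close> is at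
    most the double sum.\<close>
  have "(\<Sum>l\<in>UNIV. ?t z k l) \<le> C" if "z \<in> polydisk" for z k
    using member_le_sum[of k UNIV "\<lambda>k. \<Sum>l\<in>UNIV. ?t z k l"] C(2)[OF that]
    by (fastforce intro: sum_nonneg)
  then show ?bdd by (rule bounded_operator_of_weight_bound[OF assms C(1)])
qed

end
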